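(* Let $A\in\mathbb{R}^{n\times d}$ have singular values $\sigma_1\ge\dots\ge\sigma_d>0$, let $1\le k<d$ and $\Delta>0$, and assume that $A$ is $(k,\Delta)$-separated, i.e. $\sigma_k^2-\sigma_{k+1}^2\ge\Delta\sigma_1^2$. Let $\kappa_k=\sigma_1^2/\sigma_k^2$ and $\mathrm{sr}(A)=\|A\|_F^2/\sigma_1^2$. Let $$0<\varepsilon\le\min\Big(\kappa_k\Delta,\frac1k\Big)\mathrm{sr}(A)\,\kappa_k,\qquad \mu=\frac{\varepsilon^3k^2}{10^3\,\mathrm{sr}(A)^3\kappa_k^4},$$ and let $\tilde A\in\mathbb{R}^{\ell\times d}$ satisfy $\|A^TA-\tilde A^T\tilde A\|\le\mu\sigma_1^2$. Then for every $i\in\{1,\dots,n\}$, $$|L^k(i)-\tilde L^k(i)|\le\varepsilon k\,\frac{\|a_{(i)}\|_2^2}{\|A\|_F^2}.$$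
   Context: $\|\cdot\|$ is the operator norm and $\|\cdot\|_F$ the Frobenius norm; $a_{(i)}\in\mathbb{R}^d$ is the $i$-th row of $A$ as a column vector. Let $A=U\Sigma V^T$ and $\tilde A=\tilde U\tilde\Sigma\tilde V^T$ be SVDs with singular values in non-increasing order; $V_k,\tilde V_k\in\mathbb{R}^{d\times k}$ consist of the top $k$ right singular vectors, and $\Sigma_k,\tilde\Sigma_k$ are the $k\times k$ diagonal matrices of the top $k$ singular values of $A$ and $\tilde A$ respectively. The rank-$k$ leverage score and its estimate are $$L^k(i)=\|\Sigma_k^{-1}V_k^Ta_{(i)}\|_2^2,\qquad \tilde L^k(i)=\|\tilde\Sigma_k^{-1}\tilde V_k^Ta_{(i)}\|_2^2.$$ *)

theory Defs
  imports Complex_Main "Jordan_Normal_Form.Gauss_Jordan_Elimination"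
begin

definition l2_norm :: "real vec \<Rightarrow> real" where
  "l2_norm x = sqrt (x \<bullet> x)"

(* The set is nonempty (x = 0) and bounded above, so Sup is a genuine supremum. *)
definition op_norm :: "real mat \<Rightarrow> real" where
  "op_norm M = Sup {l2_norm (M *\<^sub>v x) | x. x \<in> carrier_vec (dim_col M) \<and> l2_norm x \<le> 1}"

definition frobenius_norm :: "real mat \<Rightarrow> real" where
  "frobenius_norm M = sqrt (\<Sum>i<dim_row M. \<Sum>j<dim_col M. (M $$ (i,j))\<^sup>2)"

(* The library's orthogonal_mat only asks for nonzero pairwise orthogonal columns,
   without normalisation, and is therefore not used for U and V. *)
definition is_svd :: "real mat \<Rightarrow> real mat \<Rightarrow> real mat \<Rightarrow> real mat \<Rightarrow> bool" where
  "is_svd A U S V \<longleftrightarrow>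
     (let n = dim_row A; d = dim_col A in
       U \<in> carrier_mat n n \<and> S \<in> carrier_mat n d \<and> V \<in> carrier_mat d d \<and>
       transpose_mat U * U = 1\<^sub>m n \<and> transpose_mat V * V = 1\<^sub>m d \<and>
       diagonal_mat S \<and>
       (\<forall>i < min n d. 0 \<le> S $$ (i,i)) \<and>
       (\<forall>i j. i \<le> j \<and> j < min n d \<longrightarrow> S $$ (j,j) \<le> S $$ (i,i)) \<and>
       A = U * S * transpose_mat V)"

(* Singular values are numbered from 1; beyond the diagonal of S they are 0, so that a matrix
   with d columns has singular values sigma_1, ..., sigma_d even if it has fewer than d rows. *)
definition singular_value :: "real mat \<Rightarrow> nat \<Rightarrow> real" where
  "singular_value S j =
     (if 1 \<le> j \<and> j \<le> min (dim_row S) (dim_col S) then S $$ (j - 1, j - 1) else 0)"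

definition top_singular_values :: "nat \<Rightarrow> real mat \<Rightarrow> real mat" where
  "top_singular_values k S = mat_diag k (\<lambda>j. singular_value S (j + 1))"

definition top_right_vectors :: "nat \<Rightarrow> real mat \<Rightarrow> real mat" where
  "top_right_vectors k V = mat (dim_row V) k (\<lambda>(i,j). V $$ (i,j))"

(* Only meaningful if the k-th singular value in S is positive: otherwise
   mat_inverse yields None. *)
definition leverage_score :: "nat \<Rightarrow> real mat \<Rightarrow> real mat \<Rightarrow> real vec \<Rightarrow> real" where
  "leverage_score k S V a =
     (l2_norm (the (mat_inverse (top_singular_values k S)) *\<^sub>v
        (transpose_mat (top_right_vectors k V) *\<^sub>v a)))\<^sup>2"

(* The relative gap of squared singular values of the matrix whose SVD has middle factor S. *)
definition separated :: "nat \<Rightarrow> real \<Rightarrow> real mat \<Rightarrow> bool" where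
  "separated k \<Delta> S \<longleftrightarrow>
     (singular_value S k)\<^sup>2 - (singular_value S (k + 1))\<^sup>2 \<ge> \<Delta> * (singular_value S 1)\<^sup>2"

end

theory Submission
  imports Defs "HOL-Analysis.L2_Norm" "Jordan_Normal_Form.Determinant"
begin

text \<open>The rank-\<open>k\<close> leverage score of \<open>a\<close> is the quadratic form at \<open>a\<close> of the truncated inverse
  \<open>P = V\<^sub>k \<Sigma>\<^sub>k\<^sup>-\<^sup>2 V\<^sub>k\<^sup>T\<close> of \<open>G = A\<^sup>T A\<close>, so it suffices to bound \<open>P - P'\<close> in operator norm. Weyl's
  inequality keeps the eigenvalues of the two Gram matrices close. The difference \<open>P - P'\<close> then splits
  into \<open>- P (G - G') P'\<close> and two products of a truncated inverse with the complementary spectral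
  projection of the other matrix, which a Davis-Kahan argument controls by \<open>\<parallel>G - G'\<parallel>\<close> over the gap.
  In terms of \<open>f = \<epsilon> k / (sr \<kappa>) \<le> 1\<close>, the hypotheses say that the gap is at least \<open>f \<sigma>\<^sub>k\<^sup>2 / k\<close> and
  that \<open>\<parallel>G - G'\<parallel> \<le> f\<^sup>3 \<sigma>\<^sub>k\<^sup>2 / (1000 k)\<close>, while the claim is \<open>\<parallel>P - P'\<parallel> \<le> f / \<sigma>\<^sub>k\<^sup>2\<close>.\<close>

section \<open>The Euclidean norm of vectors\<close>

lemma l2_norm_eq_L2_set: "l2_norm x = L2_set (vec_index x) {..<dim_vec x}"
  by (simp add: l2_norm_def L2_set_def scalar_prod_def atLeast0LessThan power2_eq_square)

lemma l2_norm_nonneg [simp]: "0 \<le> l2_norm x"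
  by (simp add: l2_norm_eq_L2_set)

lemma l2_norm_power2: "(l2_norm x)\<^sup>2 = x \<bullet> x"
proof -
  have "0 \<le> x \<bullet> x"
    by (auto simp: scalar_prod_def intro!: sum_nonneg)
  then show ?thesis
    by (simp add: l2_norm_def)
qed

lemma l2_norm_power2_sum:
  "x \<in> carrier_vec n \<Longrightarrow> (l2_norm x)\<^sup>2 = (\<Sum>i<n. (x $ i)\<^sup>2)"
  unfolding l2_norm_power2 by (auto simp: scalar_prod_def atLeast0LessThan power2_eq_square)

lemma l2_norm_eq_0_iff: "x \<in> carrier_vec n \<Longrightarrow> l2_norm x = 0 \<longleftrightarrow> x = 0\<^sub>v n"
  by (auto simp: l2_norm_eq_L2_set L2_set_eq_0_iff)

lemma abs_scalar_prod_le:
  assumes "x \<in> carrier_vec n" "y \<in> carrier_vec n"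
  shows "\<bar>x \<bullet> y\<bar> \<le> l2_norm x * l2_norm y"
proof -
  have "\<bar>x \<bullet> y\<bar> \<le> (\<Sum>i<n. \<bar>x $ i\<bar> * \<bar>y $ i\<bar>)"
    using assms by (auto simp: scalar_prod_def atLeast0LessThan abs_mult intro: order_trans[OF sum_abs])
  also have "\<dots> \<le> l2_norm x * l2_norm y"
    using assms L2_set_mult_ineq[of "vec_index x" "vec_index y" "{..<n}"]
    by (auto simp: l2_norm_eq_L2_set)
  finally show ?thesis .
qed

lemma l2_norm_add_le:
  assumes "x \<in> carrier_vec n" "y \<in> carrier_vec n"
  shows "l2_norm (x + y) \<le> l2_norm x + l2_norm y"
proof -
  have "l2_norm (x + y) = L2_set (\<lambda>i. x $ i + y $ i) {..<n}"
    using assms by (auto simp: l2_norm_eq_L2_set intro: L2_set_cong)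
  then show ?thesis
    using assms L2_set_triangle_ineq[of "vec_index x" "vec_index y" "{..<n}"]
    by (auto simp: l2_norm_eq_L2_set)
qed

lemma l2_norm_smult: "l2_norm (c \<cdot>\<^sub>v x) = \<bar>c\<bar> * l2_norm x"
  by (simp add: l2_norm_def real_sqrt_mult mult.assoc[symmetric])

section \<open>The operator norm\<close>

text \<open>A crude bound from Cauchy-Schwarz on each row. It makes the set in
  \<open>op_norm\<close> bounded above, so that its \<open>Sup\<close> is a genuine supremum, and it
  settles vectors of norm 0, which cannot be normalised.\<close>

lemma l2_norm_mult_mat_vec_le_sum:
  assumes M: "M \<in> carrier_mat m n" and x: "x \<in> carrier_vec n"
  shows "l2_norm (M *\<^sub>v x) \<le> (\<Sum>i<m. l2_norm (row M i)) * l2_norm x"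
proof -
  have "l2_norm (M *\<^sub>v x) = L2_set (\<lambda>i. row M i \<bullet> x) {..<m}"
    using M by (auto simp: l2_norm_eq_L2_set intro: L2_set_cong)
  also have "\<dots> \<le> (\<Sum>i<m. \<bar>row M i \<bullet> x\<bar>)"
    by (rule L2_set_le_sum_abs)
  also have "\<dots> \<le> (\<Sum>i<m. l2_norm (row M i) * l2_norm x)"
    using M x by (intro sum_mono abs_scalar_prod_le[of _ n]) auto
  finally show ?thesis
    by (simp add: sum_distrib_right)
qed

lemma op_norm_set_bdd_above:
  "bdd_above {l2_norm (M *\<^sub>v x) | x. x \<in> carrier_vec (dim_col M) \<and> l2_norm x \<le> 1}"
proof (rule bdd_aboveI)
  fix t
  assume "t \<in> {l2_norm (M *\<^sub>v x) | x. x \<in> carrier_vec (dim_col M) \<and> l2_norm x \<le> 1}"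
  then obtain x where x: "t = l2_norm (M *\<^sub>v x)" "x \<in> carrier_vec (dim_col M)" "l2_norm x \<le> 1"
    by auto
  have "t \<le> (\<Sum>i<dim_row M. l2_norm (row M i)) * l2_norm x"
    using l2_norm_mult_mat_vec_le_sum[of M "dim_row M" "dim_col M" x] x by auto
  also have "\<dots> \<le> (\<Sum>i<dim_row M. l2_norm (row M i))"
    using x by (intro mult_left_le) (auto intro: sum_nonneg)
  finally show "t \<le> (\<Sum>i<dim_row M. l2_norm (row M i))" .
qed

lemma l2_norm_zero: "l2_norm (0\<^sub>v n) = 0"
  by (simp add: l2_norm_eq_0_iff[of _ n])

lemma op_norm_nonneg: "0 \<le> op_norm M"
proof -
  have "l2_norm (M *\<^sub>v 0\<^sub>v (dim_col M)) \<le> op_norm M"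
    unfolding op_norm_def
    by (rule cSup_upper[OF _ op_norm_set_bdd_above]) (auto simp: l2_norm_zero)
  then show ?thesis
    using l2_norm_nonneg order_trans by blast
qed

lemma l2_norm_mult_mat_vec_le:
  assumes M: "M \<in> carrier_mat m n" and x: "x \<in> carrier_vec n"
  shows "l2_norm (M *\<^sub>v x) \<le> op_norm M * l2_norm x"
proof (cases "l2_norm x = 0")
  case True
  then show ?thesis
    using l2_norm_mult_mat_vec_le_sum[OF M x] by simp
next
  case False
  let ?y = "(1 / l2_norm x) \<cdot>\<^sub>v x"
  have "l2_norm (M *\<^sub>v ?y) \<le> op_norm M"
    unfolding op_norm_def
    by (rule cSup_upper[OF _ op_norm_set_bdd_above]) (use M x False in \<open>auto simp: l2_norm_smult\<close>)
  moreover have "M *\<^sub>v ?y = (1 / l2_norm x) \<cdot>\<^sub>v (M *\<^sub>v x)"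
    using M x by (simp add: mult_mat_vec)
  ultimately have "l2_norm (M *\<^sub>v x) / l2_norm x \<le> op_norm M"
    by (simp add: l2_norm_smult)
  moreover have "0 < l2_norm x"
    using False l2_norm_nonneg[of x] by linarith
  ultimately show ?thesis
    by (simp add: field_simps)
qed

lemma op_norm_le:
  assumes M: "M \<in> carrier_mat m n" and "0 \<le> c"
    and le: "\<And>x. x \<in> carrier_vec n \<Longrightarrow> l2_norm (M *\<^sub>v x) \<le> c * l2_norm x"
  shows "op_norm M \<le> c"
  unfolding op_norm_def
proof (rule cSup_least)
  show "{l2_norm (M *\<^sub>v x) | x. x \<in> carrier_vec (dim_col M) \<and> l2_norm x \<le> 1} \<noteq> {}"
    by (auto intro!: exI[of _ "0\<^sub>v (dim_col M)"] simp: l2_norm_zero)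
next
  fix t
  assume "t \<in> {l2_norm (M *\<^sub>v x) | x. x \<in> carrier_vec (dim_col M) \<and> l2_norm x \<le> 1}"
  then obtain x where x: "t = l2_norm (M *\<^sub>v x)" "x \<in> carrier_vec n" "l2_norm x \<le> 1"
    using M by auto
  have "c * l2_norm x \<le> c"
    using x \<open>0 \<le> c\<close> by (simp add: mult_left_le)
  then show "t \<le> c"
    using le[of x] x by linarith
qed

lemma op_norm_mult_le:
  assumes M: "M \<in> carrier_mat m n" and N: "N \<in> carrier_mat n p"
  shows "op_norm (M * N) \<le> op_norm M * op_norm N"
proof (rule op_norm_le)
  show "M * N \<in> carrier_mat m p"
    using M N by simp
next
  fix x :: "real vec"
  assume x: "x \<in> carrier_vec p"
  have "l2_norm (M * N *\<^sub>v x) = l2_norm (M *\<^sub>v (N *\<^sub>v x))"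
    using M N x by simp
  also have "\<dots> \<le> op_norm M * l2_norm (N *\<^sub>v x)"
    using M N x by (intro l2_norm_mult_mat_vec_le) auto
  also have "\<dots> \<le> op_norm M * (op_norm N * l2_norm x)"
    using N x by (intro mult_left_mono l2_norm_mult_mat_vec_le op_norm_nonneg) auto
  finally show "l2_norm (M * N *\<^sub>v x) \<le> op_norm M * op_norm N * l2_norm x"
    by (simp add: mult.assoc)
qed (simp add: op_norm_nonneg)

text \<open>A form with free bounds \<open>a\<close> and \<open>b\<close>, so that estimates of
  nested products can be chained factor by factor.\<close>

lemma op_norm_mult_le':
  assumes "M \<in> carrier_mat m n" "N \<in> carrier_mat n p" "op_norm M \<le> a" "op_norm N \<le> b"
  shows "op_norm (M * N) \<le> a * b"
  using op_norm_mult_le[OF assms(1,2)] mult_mono[OF assms(3,4)]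
    op_norm_nonneg[of M] op_norm_nonneg[of N] assms(3) by linarith

lemma op_norm_add_le:
  assumes M: "M \<in> carrier_mat m n" and N: "N \<in> carrier_mat m n"
  shows "op_norm (M + N) \<le> op_norm M + op_norm N"
proof (rule op_norm_le)
  show "M + N \<in> carrier_mat m n"
    using N by simp
next
  fix x :: "real vec"
  assume x: "x \<in> carrier_vec n"
  have "l2_norm ((M + N) *\<^sub>v x) \<le> l2_norm (M *\<^sub>v x) + l2_norm (N *\<^sub>v x)"
    using M N x by (subst add_mult_distrib_mat_vec[OF M N x], intro l2_norm_add_le[of _ m]) auto
  also have "\<dots> \<le> op_norm M * l2_norm x + op_norm N * l2_norm x"
    using M N x by (intro add_mono l2_norm_mult_mat_vec_le) auto
  finally show "l2_norm ((M + N) *\<^sub>v x) \<le> (op_norm M + op_norm N) * l2_norm x"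
    by (simp add: algebra_simps)
qed (simp add: op_norm_nonneg)

lemma op_norm_uminus_le: "op_norm (- M) \<le> op_norm M"
proof (rule op_norm_le)
  show "- M \<in> carrier_mat (dim_row M) (dim_col M)"
    by simp
next
  fix x :: "real vec"
  assume x: "x \<in> carrier_vec (dim_col M)"
  have "l2_norm (- M *\<^sub>v x) = l2_norm (M *\<^sub>v x)"
    using x by (simp add: l2_norm_def)
  then show "l2_norm (- M *\<^sub>v x) \<le> op_norm M * l2_norm x"
    using l2_norm_mult_mat_vec_le[of M "dim_row M" "dim_col M" x] x by simp
qed (rule op_norm_nonneg)

lemma op_norm_diff_le:
  assumes M: "M \<in> carrier_mat m n" and N: "N \<in> carrier_mat m n"
  shows "op_norm (M - N) \<le> op_norm M + op_norm N"
  using op_norm_add_le[OF M, of "- N"] N op_norm_uminus_le[of N] add_uminus_minus_mat[OF M N] by simp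

lemma op_norm_minus_commute:
  assumes M: "M \<in> carrier_mat m n" and N: "N \<in> carrier_mat m n"
  shows "op_norm (M - N) = op_norm (N - M)"
proof (rule antisym)
  have "M - N = - (N - M)" "N - M = - (M - N)"
    using M N by (auto intro!: eq_matI)
  then show "op_norm (M - N) \<le> op_norm (N - M)" "op_norm (N - M) \<le> op_norm (M - N)"
    using op_norm_uminus_le by metis+
qed

text \<open>With \<open>y = transpose_mat M *\<^sub>v x\<close>, the square of
  \<open>l2_norm y\<close> equals \<open>x \<bullet> (M *\<^sub>v y)\<close>, which is at most
  \<open>l2_norm x * op_norm M * l2_norm y\<close>; one factor \<open>l2_norm y\<close>
  cancels.\<close>

lemma op_norm_transpose_le:
  assumes M: "M \<in> carrier_mat m n"
  shows "op_norm (transpose_mat M) \<le> op_norm M"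
proof (rule op_norm_le)
  show "transpose_mat M \<in> carrier_mat n m"
    using M by simp
next
  fix x :: "real vec"
  assume x: "x \<in> carrier_vec m"
  let ?y = "transpose_mat M *\<^sub>v x"
  have y: "?y \<in> carrier_vec n"
    using M x by auto
  have "l2_norm ?y * l2_norm ?y = ?y \<bullet> ?y"
    by (simp add: l2_norm_power2[symmetric] power2_eq_square)
  also have "\<dots> = x \<bullet> (M *\<^sub>v ?y)"
    using M x y by (simp add: transpose_vec_mult_scalar[OF M y x] comm_scalar_prod[of _ m])
  also have "\<dots> \<le> l2_norm x * l2_norm (M *\<^sub>v ?y)"
    using abs_scalar_prod_le[of x m "M *\<^sub>v ?y"] M x y by auto
  also have "\<dots> \<le> l2_norm x * (op_norm M * l2_norm ?y)"
    using M y by (intro mult_left_mono l2_norm_mult_mat_vec_le) auto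
  finally have "l2_norm ?y * l2_norm ?y \<le> (op_norm M * l2_norm x) * l2_norm ?y"
    by (simp add: ac_simps)
  then show "l2_norm ?y \<le> op_norm M * l2_norm x"
    by (cases "l2_norm ?y = 0") (auto simp: op_norm_nonneg less_le)
qed (rule op_norm_nonneg)

section \<open>Symmetric matrices given by an eigenbasis and eigenvalues\<close>

text \<open>For orthonormal \<open>V\<close> this is the functional calculus: column
  \<open>i\<close> of \<open>V\<close> is an eigenvector with eigenvalue \<open>g i\<close>. Gram
  matrices, truncated inverses and spectral projections all take this form, so identities between
  those sharing a \<open>V\<close> reduce to identities between eigenvalues.\<close>

definition spectral_mat :: "real mat \<Rightarrow> (nat \<Rightarrow> real) \<Rightarrow> real mat" where
  "spectral_mat V g = V * mat_diag (dim_col V) g * transpose_mat V"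

definition orthonormal_mat :: "nat \<Rightarrow> real mat \<Rightarrow> bool" where
  "orthonormal_mat d V \<longleftrightarrow> V \<in> carrier_mat d d \<and> transpose_mat V * V = 1\<^sub>m d"

lemma spectral_mat_carrier [simp]:
  "V \<in> carrier_mat d d \<Longrightarrow> spectral_mat V g \<in> carrier_mat d d"
  unfolding spectral_mat_def by (metis carrier_matD(2) mat_diag_dim mult_carrier_mat transpose_carrier_mat)

lemma orthonormal_mat_carrier [simp]: "orthonormal_mat d V \<Longrightarrow> V \<in> carrier_mat d d"
  by (simp add: orthonormal_mat_def)

lemma orthonormal_mat_right_inverse:
  "orthonormal_mat d V \<Longrightarrow> V * transpose_mat V = 1\<^sub>m d"
  by (auto simp: orthonormal_mat_def intro: mat_mult_left_right_inverse)

text \<open>The inner factor \<open>transpose_mat V * V\<close> cancels, which leaves a product of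
  diagonal matrices.\<close>

lemma spectral_mat_mult:
  assumes V: "orthonormal_mat d V"
  shows "spectral_mat V g * spectral_mat V h = spectral_mat V (\<lambda>i. g i * h i)"
proof -
  have C: "V \<in> carrier_mat d d" "transpose_mat V \<in> carrier_mat d d" and
    I: "transpose_mat V * V = 1\<^sub>m d" and D: "dim_col V = d" "dim_row V = d"
    using V by (auto simp: orthonormal_mat_def)
  let ?G = "mat_diag d g" and ?H = "mat_diag d h" and ?T = "transpose_mat V"
  have "spectral_mat V g * spectral_mat V h = V * (?G * (?T * (V * (?H * ?T))))"
    using C by (simp add: spectral_mat_def D assoc_mult_mat[of _ d d _ d _ d] mult_carrier_mat[of _ d d _ d])
  also have "?T * (V * (?H * ?T)) = (?T * V) * (?H * ?T)"
    using C by (simp add: assoc_mult_mat[of _ d d _ d _ d] mult_carrier_mat[of _ d d _ d])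
  also have "\<dots> = ?H * ?T"
    using C by (simp add: I left_mult_one_mat[of _ d d] mult_carrier_mat[of _ d d _ d])
  also have "V * (?G * (?H * ?T)) = V * ((?G * ?H) * ?T)"
    using C by (simp add: assoc_mult_mat[of _ d d _ d _ d] mult_carrier_mat[of _ d d _ d] del: mat_diag_diag)
  also have "\<dots> = spectral_mat V (\<lambda>i. g i * h i)"
    using C by (simp add: spectral_mat_def D assoc_mult_mat[of _ d d _ d _ d] mult_carrier_mat[of _ d d _ d])
  finally show ?thesis .
qed

lemma spectral_mat_cong:
  assumes "V \<in> carrier_mat d d" "\<And>i. i < d \<Longrightarrow> g i = h i"
  shows "spectral_mat V g = spectral_mat V h"
proof -
  have "mat_diag d g = mat_diag d h"
    using assms by (intro eq_matI) (auto simp: mat_diag_def)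
  then show ?thesis
    using assms by (simp add: spectral_mat_def)
qed

lemma transpose_mat_diag: "transpose_mat (mat_diag d g) = mat_diag d g"
  by (intro eq_matI) (auto simp: mat_diag_def)

lemma transpose_spectral_mat:
  assumes "V \<in> carrier_mat d d"
  shows "transpose_mat (spectral_mat V g) = spectral_mat V g"
proof -
  have D: "dim_col V = d" and T: "transpose_mat V \<in> carrier_mat d d"
    using assms by auto
  show ?thesis
    using assms T unfolding spectral_mat_def D
    by (simp add: transpose_mult[of _ d d _ d] transpose_mat_diag
        mult_carrier_mat[of _ d d] assoc_mult_mat[of _ d d _ d _ d])
qed

lemma spectral_mat_one: "orthonormal_mat d V \<Longrightarrow> spectral_mat V (\<lambda>_. 1) = 1\<^sub>m d"
  using orthonormal_mat_right_inverse[of d V]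
  by (auto simp: spectral_mat_def orthonormal_mat_def)

lemma mat_diag_mult_vec_index:
  fixes y :: "real vec"
  assumes y: "y \<in> carrier_vec d" and i: "i < d"
  shows "(mat_diag d g *\<^sub>v y) $ i = g i * y $ i"
proof -
  have "(mat_diag d g *\<^sub>v y) $ i = (\<Sum>j\<in>{0..<d}. (if i = j then g j else 0) * y $ j)"
    using i y by (auto simp: mat_diag_def scalar_prod_def intro!: sum.cong)
  also have "\<dots> = g i * y $ i"
    using i by (simp add: if_distrib[of "\<lambda>t. t * _"] cong: if_cong)
  finally show ?thesis .
qed

lemma spectral_mat_quadratic_form:
  assumes V: "V \<in> carrier_mat d d" and x: "x \<in> carrier_vec d"
  shows "x \<bullet> (spectral_mat V g *\<^sub>v x) = (\<Sum>i<d. g i * ((transpose_mat V *\<^sub>v x) $ i)\<^sup>2)"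
proof -
  let ?y = "transpose_mat V *\<^sub>v x"
  have D: "dim_col V = d" and T: "transpose_mat V \<in> carrier_mat d d"
    and y: "?y \<in> carrier_vec d" using V x by auto
  have z: "mat_diag d g *\<^sub>v ?y \<in> carrier_vec d"
    using y by (metis mat_diag_dim mult_mat_vec_carrier)
  have "spectral_mat V g *\<^sub>v x = V *\<^sub>v (mat_diag d g *\<^sub>v ?y)"
    using V x T by (simp add: spectral_mat_def D assoc_mult_mat_vec[of _ d d _ d] mult_carrier_mat[of _ d d])
  then have "x \<bullet> (spectral_mat V g *\<^sub>v x) = x \<bullet> (V *\<^sub>v (mat_diag d g *\<^sub>v ?y))"
    by simp
  also have "\<dots> = ?y \<bullet> (mat_diag d g *\<^sub>v ?y)"
    by (rule transpose_vec_mult_scalar[OF V z x, symmetric])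
  also have "\<dots> = (\<Sum>i<d. ?y $ i * (g i * ?y $ i))"
    using carrier_vecD[OF z] y by (auto simp: scalar_prod_def atLeast0LessThan mat_diag_mult_vec_index
        simp del: index_mult_mat_vec dim_mult_mat_vec intro!: sum.cong)
  finally show ?thesis
    by (simp add: power2_eq_square ac_simps)
qed

text \<open>Parseval's identity, as the quadratic form whose eigenvalues are all 1.\<close>

lemma l2_norm_orthonormal_coordinates:
  assumes V: "orthonormal_mat d V" and x: "x \<in> carrier_vec d"
  shows "(l2_norm x)\<^sup>2 = (\<Sum>i<d. ((transpose_mat V *\<^sub>v x) $ i)\<^sup>2)"
  using spectral_mat_quadratic_form[of V d x "\<lambda>_. 1"] V x
  by (simp add: spectral_mat_one l2_norm_power2)

text \<open>By symmetry the squared length of the image of \<open>x\<close> is the quadratic form of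
  the squared matrix, whose eigenvalues are the squares of \<open>g i\<close>; in the coordinates of
  \<open>V\<close> the bound holds term by term.\<close>

lemma op_norm_spectral_mat_le:
  assumes V: "orthonormal_mat d V" and "0 \<le> c" and le: "\<And>i. i < d \<Longrightarrow> \<bar>g i\<bar> \<le> c"
  shows "op_norm (spectral_mat V g) \<le> c"
proof (rule op_norm_le)
  show "spectral_mat V g \<in> carrier_mat d d"
    using V by simp
next
  fix x :: "real vec"
  assume x: "x \<in> carrier_vec d"
  let ?G = "spectral_mat V g" and ?y = "transpose_mat V *\<^sub>v x"
  have C: "V \<in> carrier_mat d d" and G: "?G \<in> carrier_mat d d" "?G *\<^sub>v x \<in> carrier_vec d"
    using V x by (simp_all add: mult_mat_vec_carrier[of _ d d])
  have "(l2_norm (?G *\<^sub>v x))\<^sup>2 = x \<bullet> (?G *\<^sub>v (?G *\<^sub>v x))"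
    using transpose_vec_mult_scalar[OF G x] transpose_spectral_mat[OF C, of g]
    by (simp add: l2_norm_power2)
  also have "\<dots> = x \<bullet> (spectral_mat V (\<lambda>i. g i * g i) *\<^sub>v x)"
    using G x by (simp add: assoc_mult_mat_vec[of _ d d _ d, symmetric] spectral_mat_mult[OF V])
  also have "\<dots> = (\<Sum>i<d. (g i)\<^sup>2 * (?y $ i)\<^sup>2)"
    by (simp only: spectral_mat_quadratic_form[OF C x] power2_eq_square)
  also have "\<dots> \<le> (\<Sum>i<d. c\<^sup>2 * (?y $ i)\<^sup>2)"
    using le \<open>0 \<le> c\<close> by (intro sum_mono mult_right_mono) (auto simp: abs_le_square_iff[symmetric])
  also have "\<dots> = (c * l2_norm x)\<^sup>2"
    by (simp add: l2_norm_orthonormal_coordinates[OF V x] power_mult_distrib sum_distrib_left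
        del: index_mult_mat_vec)
  finally show "l2_norm (?G *\<^sub>v x) \<le> c * l2_norm x"
    using \<open>0 \<le> c\<close> by (auto intro: power2_le_imp_le)
qed (rule assms)

section \<open>Weyl's inequality\<close>

text \<open>A dimension count: there are \<open>d - p - 1\<close> linear conditions from
  \<open>V\<close> and \<open>p\<close> from \<open>W\<close>, hence \<open>d - 1\<close> conditions
  on \<open>d\<close> unknowns.\<close>

lemma exists_nonzero_split_orthogonal:
  assumes V: "V \<in> carrier_mat d d" and W: "W \<in> carrier_mat d d" and p: "p < d"
  obtains x :: "real vec" where "x \<in> carrier_vec d" "x \<noteq> 0\<^sub>v d"
    "\<And>i. p < i \<Longrightarrow> i < d \<Longrightarrow> (transpose_mat V *\<^sub>v x) $ i = 0"
    "\<And>i. i < p \<Longrightarrow> (transpose_mat W *\<^sub>v x) $ i = 0"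
proof -
  let ?c = "\<lambda>i. if i < p then col W i else col V i"
  \<comment> \<open>The conditions fill every row except row \<open>p\<close>; the zero row there
    makes the system square and singular, so a determinant argument yields \<open>x\<close>.\<close>
  let ?C = "mat\<^sub>r d d (\<lambda>i. if i = p then 0\<^sub>v d else ?c i)"
  have C: "?C \<in> carrier_mat d d" by simp
  have "det ?C = 0"
    by (rule det_row_0[OF p]) (use V W in auto)
  then obtain x where x: "x \<in> carrier_vec d" "x \<noteq> 0\<^sub>v d" "?C *\<^sub>v x = 0\<^sub>v d"
    using det_0_iff_vec_prod_zero[OF C] by auto
  have row: "?c i \<bullet> x = 0" if "i < d" "i \<noteq> p" for i
  proof -
    have "row ?C i = ?c i"
      using that V W by (intro eq_vecI) auto
    moreover have "(?C *\<^sub>v x) $ i = 0"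
      using x(3) that by simp
    ultimately show ?thesis
      using that by simp
  qed
  show ?thesis
  proof (rule that[OF x(1,2)])
    show "(transpose_mat V *\<^sub>v x) $ i = 0" if "p < i" "i < d" for i
      using row[of i] that V by simp
    show "(transpose_mat W *\<^sub>v x) $ i = 0" if "i < p" for i
      using row[of i] that W p by simp
  qed
qed

text \<open>The Courant-Fischer argument: some nonzero \<open>x\<close> lies both in the span of the
  columns \<open>0..p\<close> of \<open>V\<close>, where the first form is at least
  \<open>g p\<close> times the squared norm, and in the span of the columns of \<open>W\<close> from
  \<open>p\<close> on, where the second is at most \<open>h p\<close> times it. The two forms at
  \<open>x\<close> differ by at most the operator norm of the difference times the squared
  norm.\<close>

lemma weyl_eigenvalue_perturbation:
  assumes V: "orthonormal_mat d V" and W: "orthonormal_mat d W" and p: "p < d"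
    and g: "\<And>i. i \<le> p \<Longrightarrow> g p \<le> g i" and h: "\<And>i. p \<le> i \<Longrightarrow> i < d \<Longrightarrow> h i \<le> h p"
  shows "g p \<le> h p + op_norm (spectral_mat V g - spectral_mat W h)"
proof -
  let ?G = "spectral_mat V g" and ?H = "spectral_mat W h"
  have C: "V \<in> carrier_mat d d" "W \<in> carrier_mat d d"
    using V W by auto
  obtain x where x: "x \<in> carrier_vec d" "x \<noteq> 0\<^sub>v d"
    and xV: "\<And>i. p < i \<Longrightarrow> i < d \<Longrightarrow> (transpose_mat V *\<^sub>v x) $ i = 0"
    and xW: "\<And>i. i < p \<Longrightarrow> (transpose_mat W *\<^sub>v x) $ i = 0"
    using exists_nonzero_split_orthogonal[OF C p] by blast
  have "g p * (l2_norm x)\<^sup>2 \<le> x \<bullet> (?G *\<^sub>v x)"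
    unfolding spectral_mat_quadratic_form[OF C(1) x(1)] l2_norm_orthonormal_coordinates[OF V x(1)]
      sum_distrib_left
  proof (intro sum_mono)
    fix i assume "i \<in> {..<d}"
    then show "g p * ((transpose_mat V *\<^sub>v x) $ i)\<^sup>2 \<le> g i * ((transpose_mat V *\<^sub>v x) $ i)\<^sup>2"
      using g[of i] xV[of i] by (cases "i \<le> p") (auto intro: mult_right_mono)
  qed
  moreover have "x \<bullet> (?H *\<^sub>v x) \<le> h p * (l2_norm x)\<^sup>2"
    unfolding spectral_mat_quadratic_form[OF C(2) x(1)] l2_norm_orthonormal_coordinates[OF W x(1)]
      sum_distrib_left
  proof (intro sum_mono)
    fix i assume "i \<in> {..<d}"
    then show "h i * ((transpose_mat W *\<^sub>v x) $ i)\<^sup>2 \<le> h p * ((transpose_mat W *\<^sub>v x) $ i)\<^sup>2"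
      using h[of i] xW[of i] by (cases "p \<le> i") (auto intro: mult_right_mono)
  qed
  moreover have "x \<bullet> (?G *\<^sub>v x) - x \<bullet> (?H *\<^sub>v x) \<le> op_norm (?G - ?H) * (l2_norm x)\<^sup>2"
  proof -
    have M: "?G \<in> carrier_mat d d" "?H \<in> carrier_mat d d" "?G - ?H \<in> carrier_mat d d"
      using C by (auto intro: minus_carrier_mat)
    have "x \<bullet> (?G *\<^sub>v x) - x \<bullet> (?H *\<^sub>v x) = x \<bullet> ((?G - ?H) *\<^sub>v x)"
      using M x by (simp add: minus_mult_distrib_mat_vec[of _ d d] scalar_prod_minus_distrib[of _ d]
          mult_mat_vec_carrier[of _ d d])
    also have "\<dots> \<le> l2_norm x * l2_norm ((?G - ?H) *\<^sub>v x)"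
      using abs_scalar_prod_le[of x d "(?G - ?H) *\<^sub>v x"] M x
      by (simp add: mult_mat_vec_carrier[of _ d d])
    also have "\<dots> \<le> l2_norm x * (op_norm (?G - ?H) * l2_norm x)"
      using M x by (intro mult_left_mono l2_norm_mult_mat_vec_le) auto
    finally show ?thesis
      by (simp add: power2_eq_square ac_simps)
  qed
  ultimately have "g p * (l2_norm x)\<^sup>2 \<le> (h p + op_norm (?G - ?H)) * (l2_norm x)\<^sup>2"
    by (simp add: algebra_simps)
  moreover have "0 < (l2_norm x)\<^sup>2"
    using l2_norm_eq_0_iff[OF x(1)] x(2) by simp
  ultimately show ?thesis
    by simp
qed

section \<open>Truncated inverses and the Davis-Kahan bound\<close>

lemma spectral_mat_complement:
  assumes V: "orthonormal_mat d V"
  shows "spectral_mat V (\<lambda>i. if i < k then 1 else 0)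
    = 1\<^sub>m d - spectral_mat V (\<lambda>i. if i < k then 0 else 1)"
proof -
  have C: "V \<in> carrier_mat d d" using V by simp
  have D: "mat_diag d (\<lambda>i. if i < k then 1 else 0 :: real)
      = 1\<^sub>m d - mat_diag d (\<lambda>i. if i < k then 0 else 1)"
    by (intro eq_matI) (auto simp: mat_diag_def)
  show ?thesis
    using C orthonormal_mat_right_inverse[OF V]
    by (simp add: spectral_mat_def D mult_minus_distrib_mat[of _ d d _ d]
        minus_mult_distrib_mat[of _ d d _ _ d] mult_carrier_mat[of _ d d _ d])
qed

text \<open>The eigenvalues of the truncated inverse: if \<open>g\<close> lists the squared singular
  values, \<open>spectral_mat V (top_inverse k g)\<close> is the \<open>d\<close> by
  \<open>d\<close> matrix
  \<open>V\<^sub>k \<Sigma>\<^sub>k\<^sup>-\<^sup>2 V\<^sub>k\<^sup>T\<close>.\<close>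

definition top_inverse :: "nat \<Rightarrow> (nat \<Rightarrow> real) \<Rightarrow> nat \<Rightarrow> real" where
  "top_inverse k g i = (if i < k then 1 / g i else 0)"

lemma op_norm_top_inverse_le:
  assumes V: "orthonormal_mat d V" and a: "0 < a"
    and g: "\<And>i. i < k \<Longrightarrow> i < d \<Longrightarrow> a \<le> g i"
  shows "op_norm (spectral_mat V (top_inverse k g)) \<le> 1 / a"
proof (rule op_norm_spectral_mat_le[OF V])
  fix i assume "i < d"
  show "\<bar>top_inverse k g i\<bar> \<le> 1 / a"
  proof (cases "i < k")
    case True
    then have "a \<le> g i" using g \<open>i < d\<close> by simp
    then show ?thesis
      using a True by (simp add: top_inverse_def frac_le)
  qed (use a in \<open>simp add: top_inverse_def\<close>)
qed (use a in simp)

text \<open>Writing \<open>P\<close> for the truncated inverse of \<open>G\<close> and \<open>R\<close> for the lower spectral projection of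
  \<open>H\<close>, the identity \<open>P R = P (P R H R + P (G - H) R)\<close> bounds the norm of \<open>P R\<close> by a multiple,
  smaller than 1, of itself plus an error term.\<close>

lemma op_norm_top_inverse_lower_projection_le:
  assumes V: "orthonormal_mat d V" and W: "orthonormal_mat d W"
    and b: "0 \<le> b" "b < a"
    and g: "\<And>i. i < k \<Longrightarrow> i < d \<Longrightarrow> a \<le> g i"
    and h: "\<And>i. k \<le> i \<Longrightarrow> i < d \<Longrightarrow> \<bar>h i\<bar> \<le> b"
  shows "op_norm (spectral_mat V (top_inverse k g) * spectral_mat W (\<lambda>i. if i < k then 0 else 1))
    \<le> op_norm (spectral_mat V g - spectral_mat W h) / (a * (a - b))"
proof -
  define G H P R where "G = spectral_mat V g" and "H = spectral_mat W h"
    and "P = spectral_mat V (top_inverse k g)"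
    and "R = spectral_mat W (\<lambda>i. if i < k then 0 else 1)"
  define RHR where "RHR = spectral_mat W (\<lambda>i. if i < k then 0 else h i)"
  define x where "x = op_norm (P * R)"
  define \<eta> where "\<eta> = op_norm (G - H)"
  have a: "0 < a" using b by simp
  have C: "V \<in> carrier_mat d d" "W \<in> carrier_mat d d"
    using V W by auto
  have M: "G \<in> carrier_mat d d" "H \<in> carrier_mat d d" "P \<in> carrier_mat d d"
    "R \<in> carrier_mat d d" "RHR \<in> carrier_mat d d" "G - H \<in> carrier_mat d d"
    using C by (auto simp: G_def H_def P_def R_def RHR_def intro: minus_carrier_mat)
  \<comment> \<open>\<open>P * G\<close> is the projection onto the top eigenvectors of
    \<open>G\<close>, which \<open>P\<close> absorbs.\<close>
  have PPG: "P * (P * G) = P"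
    unfolding P_def G_def spectral_mat_mult[OF V]
  proof (rule spectral_mat_cong[OF C(1)])
    fix i assume "i < d"
    then show "top_inverse k g i * (top_inverse k g i * g i) = top_inverse k g i"
      using g[of i] a by (auto simp: top_inverse_def)
  qed
  \<comment> \<open>\<open>H\<close> preserves the range of \<open>R\<close> and acts there as
    \<open>RHR\<close>, whose norm is at most \<open>b\<close>.\<close>
  have HR: "H * R = R * RHR"
    unfolding R_def H_def RHR_def spectral_mat_mult[OF W]
    by (rule spectral_mat_cong[OF C(2)]) auto
  have "P * R = P * (P * G) * R"
    by (simp add: PPG)
  also have "\<dots> = P * (P * (G * R))"
    using M by (simp add: assoc_mult_mat[of _ d d _ d _ d] mult_carrier_mat[of _ d d _ d])
  also have "G * R = H * R + (G - H) * R"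
    using M by (simp add: add_mult_distrib_mat[of _ d d _ _ d, symmetric] mult_carrier_mat[of _ d d _ d])
      (intro arg_cong[where f = "\<lambda>X. X * R"] eq_matI, auto)
  also have "P * (P * (H * R + (G - H) * R)) = P * ((P * R) * RHR + P * ((G - H) * R))"
    using M by (simp add: HR mult_add_distrib_mat[of _ d d _ d] mult_carrier_mat[of _ d d _ d]
        assoc_mult_mat[of _ d d _ d _ d])
  finally have PR: "P * R = P * ((P * R) * RHR + P * ((G - H) * R))" .
  have nP: "op_norm P \<le> 1 / a"
    unfolding P_def by (rule op_norm_top_inverse_le[OF V a g])
  have nR: "op_norm R \<le> 1"
    unfolding R_def by (rule op_norm_spectral_mat_le[OF W]) auto
  have nRHR: "op_norm RHR \<le> b"
    unfolding RHR_def by (rule op_norm_spectral_mat_le[OF W]) (use b h in auto)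
  have "op_norm ((P * R) * RHR + P * ((G - H) * R))
      \<le> op_norm ((P * R) * RHR) + op_norm (P * ((G - H) * R))"
    using M by (intro op_norm_add_le[of _ d d]) (auto simp: mult_carrier_mat[of _ d d _ d])
  also have "\<dots> \<le> x * b + 1 / a * (\<eta> * 1)"
    using M nP nR nRHR
    by (intro add_mono op_norm_mult_le'[of _ d d _ d])
      (auto simp: x_def \<eta>_def mult_carrier_mat[of _ d d _ d]
        intro: op_norm_mult_le'[of _ d d _ d, where b = 1, simplified])
  finally have "op_norm (P * ((P * R) * RHR + P * ((G - H) * R))) \<le> 1 / a * (x * b + 1 / a * (\<eta> * 1))"
    using M nP by (intro op_norm_mult_le'[of _ d d _ d])
      (auto simp: mult_carrier_mat[of _ d d _ d] add_carrier_mat)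
  then have "x \<le> 1 / a * (x * b + 1 / a * (\<eta> * 1))"
    using PR by (simp add: x_def)
  also have "\<dots> = (x * b + \<eta> / a) / a"
    by simp
  finally have "x * (a - b) \<le> \<eta> / a"
    using a by (simp add: pos_le_divide_eq algebra_simps)
  then have "x \<le> \<eta> / a / (a - b)"
    using b by (simp add: pos_le_divide_eq del: divide_divide_eq_left)
  then show ?thesis
    by (simp add: x_def \<eta>_def G_def H_def P_def R_def mult.commute)
qed

text \<open>With \<open>P\<close>, \<open>Q\<close> the truncated inverses and \<open>RV\<close>, \<open>RW\<close> the lower spectral projections, the
  perturbation splits as \<open>P - Q = P RW - RV Q - P (G - H) Q\<close>.\<close>

lemma op_norm_top_inverse_diff_le:
  assumes V: "orthonormal_mat d V" and W: "orthonormal_mat d W"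
    and b: "0 \<le> b" "b < a'" and b': "0 \<le> b'" "b' < a"
    and g: "\<And>i. i < k \<Longrightarrow> i < d \<Longrightarrow> a \<le> g i" "\<And>i. k \<le> i \<Longrightarrow> i < d \<Longrightarrow> \<bar>g i\<bar> \<le> b"
    and h: "\<And>i. i < k \<Longrightarrow> i < d \<Longrightarrow> a' \<le> h i" "\<And>i. k \<le> i \<Longrightarrow> i < d \<Longrightarrow> \<bar>h i\<bar> \<le> b'"
  defines "\<eta> \<equiv> op_norm (spectral_mat V g - spectral_mat W h)"
  shows "op_norm (spectral_mat V (top_inverse k g) - spectral_mat W (top_inverse k h))
    \<le> \<eta> / (a * a') + \<eta> / (a * (a - b')) + \<eta> / (a' * (a' - b))"
proof -
  define G H P Q where "G = spectral_mat V g" and "H = spectral_mat W h"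
    and "P = spectral_mat V (top_inverse k g)" and "Q = spectral_mat W (top_inverse k h)"
  define RV RW where "RV = spectral_mat V (\<lambda>i. if i < k then 0 else 1)"
    and "RW = spectral_mat W (\<lambda>i. if i < k then 0 else 1)"
  have a: "0 < a" "0 < a'" using b b' by auto
  have C: "V \<in> carrier_mat d d" "W \<in> carrier_mat d d"
    using V W by auto
  have M: "G \<in> carrier_mat d d" "H \<in> carrier_mat d d" "P \<in> carrier_mat d d" "Q \<in> carrier_mat d d"
    "RV \<in> carrier_mat d d" "RW \<in> carrier_mat d d" "G - H \<in> carrier_mat d d"
    using C by (auto simp: G_def H_def P_def Q_def RV_def RW_def intro: minus_carrier_mat)
  have PG: "P * G = 1\<^sub>m d - RV"
    unfolding P_def G_def RV_def spectral_mat_mult[OF V] spectral_mat_complement[OF V, symmetric]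
  proof (rule spectral_mat_cong[OF C(1)])
    fix i assume "i < d"
    then show "top_inverse k g i * g i = (if i < k then 1 else 0)"
      using g(1)[of i] a by (auto simp: top_inverse_def)
  qed
  have HQ: "H * Q = 1\<^sub>m d - RW"
    unfolding Q_def H_def RW_def spectral_mat_mult[OF W] spectral_mat_complement[OF W, symmetric]
  proof (rule spectral_mat_cong[OF C(2)])
    fix i assume "i < d"
    then show "h i * top_inverse k h i = (if i < k then 1 else 0)"
      using h(1)[of i] a by (auto simp: top_inverse_def)
  qed
  \<comment> \<open>A resolvent identity: for full inverses the left side would be
    \<open>Q - P\<close>; truncation adds the corrections \<open>RV * Q\<close> and
    \<open>P * RW\<close>.\<close>
  have "P * ((G - H) * Q) = (P * G) * Q - P * (H * Q)"
    using M by (simp add: minus_mult_distrib_mat[of _ d d _ _ d] mult_minus_distrib_mat[of _ d d _ d]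
        mult_carrier_mat[of _ d d _ d] assoc_mult_mat[of _ d d _ d _ d])
  also have "\<dots> = (Q - RV * Q) - (P - P * RW)"
    using M by (simp add: PG HQ minus_mult_distrib_mat[of _ d d _ _ d] mult_minus_distrib_mat[of _ d d _ d])
  finally have E: "P * ((G - H) * Q) = (Q - RV * Q) - (P - P * RW)" .
  have N: "P * RW \<in> carrier_mat d d" "RV * Q \<in> carrier_mat d d" "P * ((G - H) * Q) \<in> carrier_mat d d"
    "P * RW - RV * Q \<in> carrier_mat d d"
    using M by (auto simp: mult_carrier_mat[of _ d d _ d] minus_carrier_mat)
  have "P - Q = (P * RW - RV * Q) - P * ((G - H) * Q)"
    unfolding E using M N(1,2) by (intro eq_matI) auto
  then have "op_norm (P - Q) \<le> op_norm (P * RW) + op_norm (RV * Q) + op_norm (P * ((G - H) * Q))"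
    using op_norm_diff_le[OF N(4,3)] op_norm_diff_le[OF N(1,2)] by simp
  also have "op_norm (P * RW) \<le> \<eta> / (a * (a - b'))"
    unfolding P_def RW_def \<eta>_def
    by (rule op_norm_top_inverse_lower_projection_le[OF V W b' g(1) h(2)])
  also have "op_norm (RV * Q) \<le> \<eta> / (a' * (a' - b))"
  proof -
    \<comment> \<open>Here the projection stands on the left; transposing brings the product into
      the form of the previous lemma with the two matrices exchanged.\<close>
    have "RV * Q = transpose_mat (Q * RV)"
      using M C by (simp add: transpose_mult[of _ d d _ d] Q_def RV_def transpose_spectral_mat)
    then have "op_norm (RV * Q) \<le> op_norm (Q * RV)"
      using op_norm_transpose_le[of "Q * RV" d d] M by (simp add: mult_carrier_mat[of _ d d _ d])
    also have "\<dots> \<le> op_norm (H - G) / (a' * (a' - b))"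
      unfolding Q_def RV_def H_def G_def
      by (rule op_norm_top_inverse_lower_projection_le[OF W V b h(1) g(2)])
    also have "op_norm (H - G) = \<eta>"
      using op_norm_minus_commute[OF M(1,2)] by (simp add: \<eta>_def G_def H_def)
    finally show ?thesis .
  qed
  also have "op_norm (P * ((G - H) * Q)) \<le> 1 / a * (\<eta> * (1 / a'))"
  proof -
    have nP: "op_norm P \<le> 1 / a" and nQ: "op_norm Q \<le> 1 / a'"
      unfolding P_def Q_def
      by (rule op_norm_top_inverse_le[OF V a(1) g(1)], assumption+)
        (rule op_norm_top_inverse_le[OF W a(2) h(1)], assumption+)
    have nE: "op_norm (G - H) \<le> \<eta>"
      by (simp add: \<eta>_def G_def H_def)
    show ?thesis
      by (rule op_norm_mult_le'[OF M(3) mult_carrier_mat[OF M(7,4)] nP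
            op_norm_mult_le'[OF M(7,4) nE nQ]])
  qed
  finally show ?thesis
    by (simp add: P_def Q_def)
qed

section \<open>Singular values and the Gram matrix\<close>

lemma is_svd_carrier:
  assumes "A \<in> carrier_mat n d" "is_svd A U S V"
  shows "U \<in> carrier_mat n n" "S \<in> carrier_mat n d" "orthonormal_mat d V"
  using assms(2) unfolding is_svd_def Let_def carrier_matD[OF assms(1)] orthonormal_mat_def
  by iprover+

lemma singular_value_nonneg:
  assumes "is_svd A U S V"
  shows "0 \<le> singular_value S j"
proof -
  have "S \<in> carrier_mat (dim_row A) (dim_col A)"
    and "\<forall>i < min (dim_row A) (dim_col A). 0 \<le> S $$ (i, i)"
    using assms unfolding is_svd_def Let_def by iprover+
  then show ?thesis
    by (simp add: singular_value_def carrier_matD less_eq_Suc_le)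
qed

lemma singular_value_antimono:
  assumes svd: "is_svd A U S V" and "1 \<le> i" "i \<le> j"
  shows "singular_value S j \<le> singular_value S i"
proof (cases "j \<le> min (dim_row S) (dim_col S)")
  case True
  have "S \<in> carrier_mat (dim_row A) (dim_col A)"
    and "\<forall>i j. i \<le> j \<and> j < min (dim_row A) (dim_col A) \<longrightarrow> S $$ (j, j) \<le> S $$ (i, i)"
    using svd unfolding is_svd_def Let_def by iprover+
  moreover have "i - 1 \<le> j - 1" "j - 1 < min (dim_row S) (dim_col S)"
    using assms(2,3) True by auto
  ultimately have "S $$ (j - 1, j - 1) \<le> S $$ (i - 1, i - 1)"
    by (metis carrier_matD)
  then show ?thesis
    using assms(2,3) True by (simp add: singular_value_def)
next
  \<comment> \<open>Beyond the diagonal the default value 0 lies below every singular value.\<close>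
  case False
  then have "singular_value S j = 0"
    by (auto simp: singular_value_def)
  then show ?thesis
    using singular_value_nonneg[OF svd, of i] by simp
qed

lemma svd_gram_matrix:
  assumes A: "A \<in> carrier_mat n d" and svd: "is_svd A U S V"
  shows "transpose_mat A * A = spectral_mat V (\<lambda>i. (singular_value S (i + 1))\<^sup>2)"
proof -
  note C = is_svd_carrier[OF A svd]
  have V: "V \<in> carrier_mat d d" using C by simp
  have eq: "A = U * S * transpose_mat V" "transpose_mat U * U = 1\<^sub>m n" and diag: "diagonal_mat S"
    using svd unfolding is_svd_def Let_def carrier_matD[OF A] by iprover+
  have SS: "transpose_mat S * S = mat_diag d (\<lambda>i. (singular_value S (i + 1))\<^sup>2)"
  proof (rule eq_matI)
    fix i j
    assume "i < dim_row (mat_diag d (\<lambda>i. (singular_value S (i + 1))\<^sup>2))"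
      "j < dim_col (mat_diag d (\<lambda>i. (singular_value S (i + 1))\<^sup>2))"
    then have ij: "i < d" "j < d"
      by (auto simp: mat_diag_def)
    have off: "S $$ (r, c) = 0" if "r < n" "c < d" "r \<noteq> c" for r c
      using diag C(2) that by (auto simp: diagonal_mat_def)
    have "(transpose_mat S * S) $$ (i, j) = (\<Sum>r\<in>{0..<n}. S $$ (r, i) * S $$ (r, j))"
      using ij C(2) by (simp add: scalar_prod_def)
    also have "\<dots> = (\<Sum>r\<in>{0..<n}. if r = i then S $$ (i, i) * S $$ (i, j) else 0)"
      by (intro sum.cong) (use off ij in auto)
    also have "\<dots> = (if i < n then S $$ (i, i) * S $$ (i, j) else 0)"
      by simp
    \<comment> \<open>For \<open>n \<le> i\<close> column \<open>i\<close> of \<open>S\<close> is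
      zero, in agreement with the default value of \<open>singular_value\<close>; so matrices with
      fewer rows than columns are covered.\<close>
    also have "\<dots> = (if i = j then (singular_value S (i + 1))\<^sup>2 else 0)"
      using C(2) ij off by (auto simp: singular_value_def power2_eq_square)
    finally show "(transpose_mat S * S) $$ (i, j) = mat_diag d (\<lambda>i. (singular_value S (i + 1))\<^sup>2) $$ (i, j)"
      using ij by (simp add: mat_diag_def)
  qed (use C(2) in \<open>auto simp: mat_diag_def\<close>)
  let ?T = "transpose_mat V"
  have T: "?T \<in> carrier_mat d d" "transpose_mat S \<in> carrier_mat d n" "transpose_mat U \<in> carrier_mat n n"
    "S * ?T \<in> carrier_mat n d" "transpose_mat S * S \<in> carrier_mat d d"
    using V C by auto
  have A': "A = U * (S * ?T)"
    using C T by (simp add: eq(1) assoc_mult_mat[of _ n n _ d _ d])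
  have AT: "transpose_mat A = V * transpose_mat S * transpose_mat U"
    unfolding A' using C T V by (simp add: transpose_mult[of _ n n _ d] transpose_mult[of _ n d _ d])
  have "transpose_mat A * A = V * transpose_mat S * (transpose_mat U * U) * (S * ?T)"
    unfolding AT unfolding A'
    using C T V by (simp add: assoc_mult_mat[of _ d n _ n _ d] assoc_mult_mat[of _ d n _ n _ n]
        assoc_mult_mat[of _ n n _ n _ d] mult_carrier_mat[of _ d d _ n] mult_carrier_mat[of _ n n _ d]
        mult_carrier_mat[of _ n n _ n])
  also have "\<dots> = V * (transpose_mat S * S) * ?T"
    unfolding eq(2) using C T V
    by (simp add: right_mult_one_mat[of _ d n] mult_carrier_mat[of _ d d _ n] mult_carrier_mat[of _ d n _ d]
        mult_carrier_mat[of _ n d _ d] assoc_mult_mat[of _ d d _ n _ d] assoc_mult_mat[of _ d d _ d _ d]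
        assoc_mult_mat[of _ d n _ d _ d])
  also have "\<dots> = spectral_mat V (\<lambda>i. (singular_value S (i + 1))\<^sup>2)"
    using V by (simp add: SS spectral_mat_def)
  finally show ?thesis .
qed

section \<open>Leverage scores as quadratic forms\<close>

text \<open>The result of the elimination is identified indirectly: invertibility excludes
  \<open>None\<close>, and a left inverse must equal the explicit right inverse.\<close>

lemma mat_inverse_mat_diag:
  fixes s :: "nat \<Rightarrow> real"
  assumes "\<And>i. i < k \<Longrightarrow> s i \<noteq> 0"
  shows "mat_inverse (mat_diag k s) = Some (mat_diag k (\<lambda>i. 1 / s i))"
proof -
  let ?S = "mat_diag k s" and ?I = "mat_diag k (\<lambda>i. 1 / s i)"
  have C: "?S \<in> carrier_mat k k" "?I \<in> carrier_mat k k" by auto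
  have "mat_diag k (\<lambda>i. s i * (1 / s i)) = 1\<^sub>m k" "mat_diag k (\<lambda>i. 1 / s i * s i) = 1\<^sub>m k"
    using assms by (auto intro!: eq_matI simp: mat_diag_def)
  then have I: "?S * ?I = 1\<^sub>m k" "?I * ?S = 1\<^sub>m k"
    by (simp_all only: mat_diag_diag)
  then have "?S \<in> Units (ring_mat TYPE(real) k b)" for b :: "unit"
    using C unfolding Units_def ring_mat_def mem_Collect_eq by (metis monoid.select_convs partial_object.select_convs(1))
  then obtain B where B: "mat_inverse ?S = Some B"
    using mat_inverse(1)[OF C(1)] by fastforce
  have B': "B * ?S = 1\<^sub>m k" "B \<in> carrier_mat k k"
    using mat_inverse(2)[OF C(1) B] by auto
  have "B = B * (?S * ?I)"
    using B' by (simp only: I right_mult_one_mat)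
  also have "\<dots> = ?I"
    using B' C by (simp only: assoc_mult_mat[OF B'(2) C, symmetric] left_mult_one_mat)
  finally show ?thesis
    by (simp add: B)
qed

text \<open>The score sums the first \<open>k\<close> squared coordinates of \<open>a\<close> in the
  basis \<open>V\<close> with weights \<open>1 / (singular_value S (i + 1))\<^sup>2\<close>; weights
  0 on the other coordinates turn this into a form on the whole space.\<close>

lemma leverage_score_quadratic_form:
  assumes A: "A \<in> carrier_mat n d" and svd: "is_svd A U S V"
    and k: "1 \<le> k" "k \<le> d" and pos: "0 < singular_value S k" and a: "a \<in> carrier_vec d"
  shows "leverage_score k S V a
    = a \<bullet> (spectral_mat V (top_inverse k (\<lambda>i. (singular_value S (i + 1))\<^sup>2)) *\<^sub>v a)"
proof -
  let ?s = "\<lambda>i. singular_value S (i + 1)" and ?y = "transpose_mat V *\<^sub>v a"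
  let ?z = "transpose_mat (top_right_vectors k V) *\<^sub>v a"
  have V: "V \<in> carrier_mat d d"
    using is_svd_carrier[OF A svd] by simp
  have s: "0 < ?s i" if "i < k" for i
    using singular_value_antimono[OF svd, of "i + 1" k] that pos by simp
  have z: "?z \<in> carrier_vec k"
    by (intro carrier_vecI) (simp add: top_right_vectors_def)
  have zi: "?z $ i = ?y $ i" if "i < k" for i
  proof -
    have "col (top_right_vectors k V) i = col V i"
      using that k V by (intro eq_vecI) (auto simp: top_right_vectors_def)
    then show ?thesis
      using that k V by (simp add: top_right_vectors_def)
  qed
  have "the (mat_inverse (top_singular_values k S)) = mat_diag k (\<lambda>i. 1 / ?s i)"
    unfolding top_singular_values_def by (subst mat_inverse_mat_diag) (use s in force)+
  then have "leverage_score k S V a = (l2_norm (mat_diag k (\<lambda>i. 1 / ?s i) *\<^sub>v ?z))\<^sup>2"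
    by (simp add: leverage_score_def)
  also have "\<dots> = (\<Sum>i<k. ((mat_diag k (\<lambda>i. 1 / ?s i) *\<^sub>v ?z) $ i)\<^sup>2)"
    by (rule l2_norm_power2_sum) (rule mult_mat_vec_carrier[OF mat_diag_dim z])
  also have "\<dots> = (\<Sum>i<k. 1 / (?s i)\<^sup>2 * (?y $ i)\<^sup>2)"
    by (intro sum.cong) (auto simp: mat_diag_mult_vec_index[OF z] zi power_divide
        simp del: index_mult_mat_vec)
  also have "\<dots> = (\<Sum>i<d. top_inverse k (\<lambda>i. (?s i)\<^sup>2) i * (?y $ i)\<^sup>2)"
    using k by (intro sum.mono_neutral_cong_left) (auto simp: top_inverse_def)
  also have "\<dots> = a \<bullet> (spectral_mat V (top_inverse k (\<lambda>i. (?s i)\<^sup>2)) *\<^sub>v a)"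
    by (rule spectral_mat_quadratic_form[OF V a, symmetric])
  finally show ?thesis .
qed

section \<open>Numerical estimates and the perturbation bound for leverage scores\<close>

text \<open>Here \<open>x\<close>, \<open>y\<close> stand for the \<open>k\<close>-th and next
  squared singular values of the original matrix and \<open>x'\<close>, \<open>y'\<close> for those
  of the perturbed one. As \<open>\<eta>\<close> is at most a thousandth of the gap bound
  \<open>q\<close>, each perturbed quantity keeps at least half of its size.\<close>

lemma perturbation_terms_le:
  fixes f q x x' y y' \<eta> :: real
  assumes f: "0 < f" "f \<le> 1" and q: "0 < q" "q \<le> x" and \<eta>: "0 \<le> \<eta>" "\<eta> \<le> f * q / 1000"
    and x': "x \<le> x' + \<eta>" and y: "y \<le> x - q" and y': "y' \<le> y + \<eta>"
  shows "y < x'" "y' < x" "0 < x'"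
    "\<eta> / (x * x') + \<eta> / (x * (x - y')) + \<eta> / (x' * (x' - y)) \<le> f / x"
proof -
  have "f * q \<le> q"
    using f q by simp
  then have h: "x / 2 \<le> x'" "q / 2 \<le> x - y'" "q / 2 \<le> x' - y"
    using assms by linarith+
  then show "y < x'" "y' < x" "0 < x'"
    using q by auto
  have x: "0 < x" using q by simp
  have "\<eta> / (x * x') \<le> (f * q / 1000) / (x * (q / 2))"
    using h q \<eta> x f by (intro frac_le mult_left_mono mult_pos_pos) auto
  moreover have "\<eta> / (x * (x - y')) \<le> (f * q / 1000) / (x * (q / 2))"
    using h q \<eta> x f by (intro frac_le mult_left_mono mult_pos_pos) auto
  moreover have "\<eta> / (x' * (x' - y)) \<le> (f * q / 1000) / (x / 2 * (q / 2))"
    using h q \<eta> x f by (intro frac_le mult_mono mult_pos_pos) auto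
  ultimately have "\<eta> / (x * x') + \<eta> / (x * (x - y')) + \<eta> / (x' * (x' - y))
      \<le> (f * q / 1000) / (x * (q / 2)) + (f * q / 1000) / (x * (q / 2)) + (f * q / 1000) / (x / 2 * (q / 2))"
    by linarith
  \<comment> \<open>The halved denominators contribute factors 2, 2 and 4, and 8/1000 =
    1/125.\<close>
  also have "\<dots> = (f / x) * (1 / 125)"
    using q x by (simp add: field_simps)
  also have "\<dots> \<le> f / x"
    using f x by (intro mult_left_le) auto
  finally show "\<eta> / (x * x') + \<eta> / (x * (x - y')) + \<eta> / (x' * (x' - y)) \<le> f / x" .
qed

theorem theorem8:
  fixes A U S V A' U' S' V' :: "real mat"
    and n d l k :: nat
    and \<Delta> \<epsilon> :: real
  defines "\<sigma> \<equiv> singular_value S"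
  defines "\<kappa> \<equiv> (\<sigma> 1)\<^sup>2 / (\<sigma> k)\<^sup>2"
    and "sr \<equiv> (frobenius_norm A)\<^sup>2 / (\<sigma> 1)\<^sup>2"
  defines "\<mu> \<equiv> \<epsilon> ^ 3 * (real k)\<^sup>2 / (10 ^ 3 * sr ^ 3 * \<kappa> ^ 4)"
  assumes "A \<in> carrier_mat n d" and "is_svd A U S V"
    and "\<sigma> d > 0"
    and "1 \<le> k" and "k < d"
    and "\<Delta> > 0" and "separated k \<Delta> S"
    and "0 < \<epsilon>" and "\<epsilon> \<le> min (\<kappa> * \<Delta>) (1 / real k) * sr * \<kappa>"
    and "A' \<in> carrier_mat l d" and "is_svd A' U' S' V'"
    and "op_norm (transpose_mat A * A - transpose_mat A' * A') \<le> \<mu> * (\<sigma> 1)\<^sup>2"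
  shows "\<forall>i < n. \<bar>leverage_score k S V (row A i) - leverage_score k S' V' (row A i)\<bar>
           \<le> \<epsilon> * real k * (l2_norm (row A i))\<^sup>2 / (frobenius_norm A)\<^sup>2"
proof -
  note A = \<open>A \<in> carrier_mat n d\<close> and svd = \<open>is_svd A U S V\<close>
  note A' = \<open>A' \<in> carrier_mat l d\<close> and svd' = \<open>is_svd A' U' S' V'\<close>
  note k = \<open>1 \<le> k\<close> \<open>k < d\<close>
  \<comment> \<open>Indices start at 0: \<open>g (k - 1)\<close> belongs to the \<open>k\<close>-th
    singular value and \<open>g k\<close> to the next one.\<close>
  define g h where "g i = (singular_value S (i + 1))\<^sup>2" and "h i = (singular_value S' (i + 1))\<^sup>2" for i
  have V: "orthonormal_mat d V" and V': "orthonormal_mat d V'"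
    using is_svd_carrier(3)[OF A svd] is_svd_carrier(3)[OF A' svd'] .
  have g_mono: "g j \<le> g i" and h_mono: "h j \<le> h i" if "i \<le> j" for i j
    using that singular_value_antimono[OF svd, of "i + 1" "j + 1"] singular_value_nonneg[OF svd]
      singular_value_antimono[OF svd', of "i + 1" "j + 1"] singular_value_nonneg[OF svd']
    by (auto simp: g_def h_def intro!: power_mono)
  have gh_nonneg: "0 \<le> g i" "0 \<le> h i" for i
    by (simp_all add: g_def h_def)
  define s x where "s = (\<sigma> 1)\<^sup>2" and "x = (\<sigma> k)\<^sup>2"
  have \<sigma>k: "0 < \<sigma> k" "0 < \<sigma> 1"
    using singular_value_antimono[OF svd, of k d] singular_value_antimono[OF svd, of 1 d] k \<open>\<sigma> d > 0\<close>
    by (auto simp: \<sigma>_def)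
  have s: "0 < s" and x: "0 < x"
    using \<sigma>k by (auto simp: s_def x_def)
  have gk: "g (k - 1) = x" "h (k - 1) = (singular_value S' k)\<^sup>2"
    using k by (simp_all add: g_def h_def x_def \<sigma>_def)
  have \<kappa>: "\<kappa> = s / x" "0 < \<kappa>"
    using s x by (auto simp: \<kappa>_def s_def x_def)
  have gap: "\<Delta> * s \<le> x - g k"
    using \<open>separated k \<Delta> S\<close> by (simp add: separated_def g_def s_def x_def \<sigma>_def)
  define F where "F = (frobenius_norm A)\<^sup>2"
  have sr: "sr = F / s"
    by (simp add: sr_def F_def s_def)
  \<comment> \<open>If \<open>sr\<close> were 0, the upper bound on \<epsilon> would be 0 and
    contradict its positivity.\<close>
  have "sr \<noteq> 0"
    using assms(12,13) by auto
  moreover have "0 \<le> sr"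
    by (simp add: sr_def)
  ultimately have sr_pos: "0 < sr"
    by simp
  then have F: "0 < F"
    using s sr by (simp add: zero_less_divide_iff)
  define f q \<eta> where "f = \<epsilon> * k / (sr * \<kappa>)" and "q = f * x / k"
    and "\<eta> = op_norm (spectral_mat V g - spectral_mat V' h)"
  have k0: "0 < real k" using k by simp
  have f: "0 < f" using \<open>0 < \<epsilon>\<close> sr_pos \<kappa>(2) k0 by (simp add: f_def)
  \<comment> \<open>The entry \<open>1 / real k\<close> of the minimum yields
    \<open>f \<le> 1\<close>; the entry \<open>\<kappa> * \<Delta>\<close> yields
    \<open>q \<le> \<Delta> * s\<close>, so the spectral gap is at least \<open>q\<close>.\<close>
  have \<epsilon>: "\<epsilon> \<le> min (\<kappa> * \<Delta>) (1 / real k) * (sr * \<kappa>)"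
    using assms(13) by (simp only: mult.assoc)
  have "\<epsilon> \<le> 1 / k * (sr * \<kappa>)"
    by (rule order_trans[OF \<epsilon>]) (use sr_pos \<kappa>(2) in \<open>intro mult_right_mono, auto\<close>)
  then have f1: "f \<le> 1"
    using sr_pos \<kappa>(2) k0 by (simp add: f_def field_simps)
  have "\<epsilon> \<le> \<kappa> * \<Delta> * (sr * \<kappa>)"
    by (rule order_trans[OF \<epsilon>]) (use sr_pos \<kappa>(2) in \<open>intro mult_right_mono, auto\<close>)
  then have "\<epsilon> / (sr * \<kappa>) \<le> \<kappa> * \<Delta>"
    using sr_pos \<kappa>(2) by (simp add: pos_divide_le_eq)
  then have "\<epsilon> / (sr * \<kappa>) * x \<le> \<kappa> * \<Delta> * x"
    using x by (intro mult_right_mono) auto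
  then have q_le: "q \<le> \<Delta> * s"
    using k0 x by (simp add: q_def f_def \<kappa>(1) mult.commute)
  have q: "0 < q" using f x k0 by (simp add: q_def)
  have \<eta>0: "0 \<le> \<eta>" by (simp add: \<eta>_def op_norm_nonneg)
  have "\<eta> \<le> \<mu> * s"
    using assms(16) svd_gram_matrix[OF A svd] svd_gram_matrix[OF A' svd']
    by (simp add: \<eta>_def g_def[abs_def] h_def[abs_def] s_def)
  \<comment> \<open>One of the four powers of \<kappa> in \<open>\<mu>\<close> turns
    \<open>s\<close> into \<open>x\<close>; the other three complete the cube of \<open>f\<close>,
    and \<open>f * x / k\<close> is \<open>q\<close>. One spare factor \<open>f \<le> 1\<close> is
    then dropped.\<close>
  also have "\<mu> * s = f * (f * q) / 1000"
  proof -
    have "s = \<kappa> * x" using \<kappa> x by simp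
    then show ?thesis
      using \<kappa>(2) sr_pos k0
      by (simp add: \<mu>_def f_def q_def field_simps power2_eq_square power3_eq_cube power4_eq_xxxx)
  qed
  also have "\<dots> \<le> f * q / 1000"
    using f f1 q by (intro divide_right_mono mult_left_mono) auto
  finally have \<eta>: "\<eta> \<le> f * q / 1000" .
  \<comment> \<open>Weyl is used once in each direction: the \<open>k\<close>-th eigenvalue falls by
    at most \<open>\<eta>\<close>, and the next one rises by at most \<open>\<eta>\<close>.\<close>
  have weyl: "x \<le> h (k - 1) + \<eta>"
    using weyl_eigenvalue_perturbation[OF V V', of "k - 1" g h] g_mono h_mono k gk
    by (simp add: \<eta>_def)
  have weyl': "h k \<le> g k + \<eta>"
    using weyl_eigenvalue_perturbation[OF V' V, of k h g] g_mono h_mono k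
      op_norm_minus_commute[of "spectral_mat V g" d d "spectral_mat V' h"] V V'
    by (simp add: \<eta>_def)
  have "q \<le> x" "g k \<le> x - q"
    using q_le gap gh_nonneg(1)[of k] by auto
  note terms = perturbation_terms_le[OF f f1 q this(1) \<eta>0 \<eta> weyl this(2) weyl']
  define P Q where "P = spectral_mat V (top_inverse k g)" and "Q = spectral_mat V' (top_inverse k h)"
  have PQ: "P \<in> carrier_mat d d" "Q \<in> carrier_mat d d" "P - Q \<in> carrier_mat d d"
    using V V' by (auto simp: P_def Q_def intro: minus_carrier_mat)
  \<comment> \<open>The thresholds are \<open>a = x\<close>, \<open>a' = h (k - 1)\<close>,
    \<open>b = g k\<close> and \<open>b' = h k\<close>.\<close>
  have "op_norm (P - Q) \<le> \<eta> / (x * h (k - 1)) + \<eta> / (x * (x - h k)) + \<eta> / (h (k - 1) * (h (k - 1) - g k))"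
    unfolding P_def Q_def \<eta>_def
    by (rule op_norm_top_inverse_diff_le[OF V V'])
      (use terms(1,2) gh_nonneg g_mono h_mono gk(1) in \<open>auto simp flip: gk(1)\<close>)
  with terms(4) have "op_norm (P - Q) \<le> f / x"
    by linarith
  \<comment> \<open>This holds because \<open>sr * \<kappa> * x = F\<close>.\<close>
  also have "f / x = \<epsilon> * k / F"
    using s x F by (simp add: f_def \<kappa>(1) sr field_simps)
  finally have PQ_le: "op_norm (P - Q) \<le> \<epsilon> * k / F" .
  \<comment> \<open>Positivity passes from \<open>A\<close> to \<open>A'\<close> through the
    perturbation bound; it makes the inverse in the estimated score exist.\<close>
  have \<sigma>'k: "0 < singular_value S' k"
    using terms(3) gk(2) singular_value_nonneg[OF svd', of k] by (auto simp: less_le)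
  show ?thesis
  proof (intro allI impI)
    fix i assume "i < n"
    define a where "a = row A i"
    have a: "a \<in> carrier_vec d"
      using A \<open>i < n\<close> by (auto simp: a_def)
    have "leverage_score k S V a - leverage_score k S' V' a = a \<bullet> (P *\<^sub>v a) - a \<bullet> (Q *\<^sub>v a)"
      using leverage_score_quadratic_form[OF A svd k(1) less_imp_le[OF k(2)] _ a]
        leverage_score_quadratic_form[OF A' svd' k(1) less_imp_le[OF k(2)] \<sigma>'k a] \<sigma>k
      by (simp add: P_def Q_def g_def[abs_def] h_def[abs_def] \<sigma>_def)
    also have "\<dots> = a \<bullet> ((P - Q) *\<^sub>v a)"
      using PQ a by (simp add: minus_mult_distrib_mat_vec[of _ d d] scalar_prod_minus_distrib[of _ d]
          mult_mat_vec_carrier[of _ d d])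
    finally have "\<bar>leverage_score k S V a - leverage_score k S' V' a\<bar> = \<bar>a \<bullet> ((P - Q) *\<^sub>v a)\<bar>"
      by simp
    also have "\<dots> \<le> l2_norm a * l2_norm ((P - Q) *\<^sub>v a)"
      using PQ a by (intro abs_scalar_prod_le[of _ d]) (simp_all add: mult_mat_vec_carrier[of _ d d])
    also have "\<dots> \<le> l2_norm a * (op_norm (P - Q) * l2_norm a)"
      using PQ a by (intro mult_left_mono l2_norm_mult_mat_vec_le) auto
    also have "\<dots> \<le> l2_norm a * (\<epsilon> * k / F * l2_norm a)"
      using PQ_le by (intro mult_left_mono mult_right_mono) auto
    finally show "\<bar>leverage_score k S V (row A i) - leverage_score k S' V' (row A i)\<bar>
        \<le> \<epsilon> * real k * (l2_norm (row A i))\<^sup>2 / (frobenius_norm A)\<^sup>2"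
      by (simp add: a_def F_def power2_eq_square ac_simps)
  qed
qed

end
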